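(* Let $0<q<1$ and $0<s<1$. Let $$b(q,s)=\frac{\ln\frac{q^s-q}{(s-1)\ln q}}{\ln q}.$$ For $x>0$ and $c>0$, let $$f_{q,s,c}(x)=\ln\Gamma_q(x+1)-\ln\Gamma_q(x+s)-(1-s)\psi_q(x+c).$$ Then $-f_{q,s,c}(x)$ is completely monotonic on $(0,+\infty)$ if and only if $c\geq b(q,s)$.
   Context: For $0<q<1$ and $x>0$, the $q$-gamma function is $$\Gamma_q(x)=\frac{(q;q)_\infty}{(q^x;q)_\infty}(1-q)^{1-x},\qquad (a;q)_\infty=\prod_{n=0}^\infty(1-aq^n),$$ and $\psi_q=\Gamma_q'/\Gamma_q$ is its logarithmic derivative on $(0,+\infty)$. A function $f$ is completely monotonic on $(a,b)$ if it has derivatives of all orders there and $(-1)^kf^{(k)}(x)\geq0$ for all $x\in(a,b)$ and all integers $k\geq0$. *)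

theory Defs
  imports "HOL-Analysis.Analysis"
begin

definition qpochhammer_inf :: "real \<Rightarrow> real \<Rightarrow> real" where
  "qpochhammer_inf a q = (\<Prod>n. 1 - a * q ^ n)"

text \<open>The functions below are only meaningful for \<open>0 < q < 1\<close> and \<open>x > 0\<close>.\<close>

definition q_Gamma :: "real \<Rightarrow> real \<Rightarrow> real" where
  "q_Gamma q x = qpochhammer_inf q q / qpochhammer_inf (q powr x) q * (1 - q) powr (1 - x)"

definition q_psi :: "real \<Rightarrow> real \<Rightarrow> real" where
  "q_psi q x = deriv (q_Gamma q) x / q_Gamma q x"

text \<open>
  The set \<open>S\<close> is meant to be an open interval, so that the iterated derivatives on \<open>S\<close>
  depend only on the values of \<open>f\<close> on \<open>S\<close>. Since \<open>deriv\<close> is total, the existence of all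
  derivatives is required explicitly.
\<close>

definition completely_monotonic_on :: "real set \<Rightarrow> (real \<Rightarrow> real) \<Rightarrow> bool" where
  "completely_monotonic_on S f \<longleftrightarrow>
     (\<forall>k. \<forall>x\<in>S. (deriv ^^ k) f field_differentiable at x \<and> (-1) ^ k * (deriv ^^ k) f x \<ge> 0)"

definition b_bound :: "real \<Rightarrow> real \<Rightarrow> real" where
  "b_bound q s = ln ((q powr s - q) / ((s - 1) * ln q)) / ln q"

definition f_qsc :: "real \<Rightarrow> real \<Rightarrow> real \<Rightarrow> real \<Rightarrow> real" where
  "f_qsc q s c x = ln (q_Gamma q (x + 1)) - ln (q_Gamma q (x + s)) - (1 - s) * q_psi q (x + c)"

end

theory Submission imports Defs begin

text \<open>
  With \<open>z = q\<^sup>x\<close> one has \<open>ln \<Gamma>\<^sub>q(x) = C - x ln (1 - q) + (\<Sum>n\<ge>1. z\<^sup>n / (n (1 - q\<^sup>n)))\<close>, so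
  \<open>- f_qsc q s c x = (\<Sum>n\<ge>1. a\<^sub>n z\<^sup>n / (1 - q\<^sup>n))\<close> with
  \<open>a\<^sub>n = (q\<^bsup>ns\<^esup> - q\<^sup>n) / n + (1 - s) ln q q\<^bsup>nc\<^esup>\<close>. Each \<open>x\<close>-derivative multiplies the \<open>n\<close>-th term by
  \<open>n ln q < 0\<close>, so nonnegativity of all \<open>a\<^sub>n\<close> suffices for complete monotonicity, and letting
  \<open>z \<rightarrow> 0\<close> shows that \<open>a\<^sub>1 \<ge> 0\<close> is necessary. The latter is exactly \<open>c \<ge> b_bound q s\<close>.
  Finally \<open>a\<^sub>1 \<ge> 0\<close> says that \<open>q\<^sup>c\<close> is at most the mean of \<open>q\<^sup>u\<close> over \<open>u \<in> [s, 1]\<close>, whence by Jensen's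
  inequality \<open>q\<^bsup>nc\<^esup>\<close> is at most the mean of \<open>q\<^bsup>nu\<^esup>\<close>, which is \<open>a\<^sub>n \<ge> 0\<close>.
\<close>

section \<open>Power series on the interval (-1, 1)\<close>

text \<open>Radius of convergence at least 1, as needed at \<open>z = q powr x\<close> for
  \<open>0 < x\<close>.\<close>

definition unit_convergent :: "(nat \<Rightarrow> real) \<Rightarrow> bool" where
  "unit_convergent a \<longleftrightarrow> (\<forall>z. \<bar>z\<bar> < 1 \<longrightarrow> summable (\<lambda>n. a n * z ^ n))"

definition q_series :: "real \<Rightarrow> (nat \<Rightarrow> real) \<Rightarrow> real \<Rightarrow> real" where
  "q_series q a x = (\<Sum>n. a n * (q powr x) ^ n)"

lemma unit_convergentD: "unit_convergent a \<Longrightarrow> \<bar>z\<bar> < 1 \<Longrightarrow> summable (\<lambda>n. a n * z ^ n)"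
  by (simp add: unit_convergent_def)

lemma unit_convergent_bounded:
  assumes "\<And>n. \<bar>a n\<bar> \<le> B"
  shows "unit_convergent a"
  unfolding unit_convergent_def
proof (intro allI impI)
  fix z :: real
  assume z: "\<bar>z\<bar> < 1"
  have "summable (\<lambda>n. B * \<bar>z\<bar> ^ n)"
    using z by (intro summable_mult summable_geometric) auto
  moreover have "norm (a n * z ^ n) \<le> B * \<bar>z\<bar> ^ n" for n
    using mult_right_mono[OF assms[of n], of "\<bar>z\<bar> ^ n"] by (simp add: abs_mult power_abs)
  ultimately show "summable (\<lambda>n. a n * z ^ n)"
    by (rule summable_comparison_test'[where N = 0])
qed

lemma unit_convergent_mult_power:
  assumes "unit_convergent a" "0 \<le> r" "r \<le> 1"
  shows "unit_convergent (\<lambda>n. a n * r ^ n)"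
  unfolding unit_convergent_def
proof (intro allI impI)
  fix z :: real
  assume "\<bar>z\<bar> < 1"
  then have "\<bar>r * z\<bar> < 1"
    using assms(2,3) mult_left_le_one_le[of "\<bar>z\<bar>" r] by (simp add: abs_mult)
  then show "summable (\<lambda>n. a n * r ^ n * z ^ n)"
    using unit_convergentD[OF assms(1), of "r * z"] by (simp add: power_mult_distrib mult.assoc)
qed

lemma unit_convergent_add:
  "unit_convergent a \<Longrightarrow> unit_convergent b \<Longrightarrow> unit_convergent (\<lambda>n. a n + b n)"
  unfolding unit_convergent_def by (auto simp: ring_distribs intro: summable_add)

lemma unit_convergent_cmult: "unit_convergent a \<Longrightarrow> unit_convergent (\<lambda>n. k * a n)"
  unfolding unit_convergent_def by (auto simp: mult.assoc intro: summable_mult)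

text \<open>Termwise differentiation preserves the radius of convergence; a further factor z
  restores the exponent n.\<close>

lemma unit_convergent_of_nat_mult:
  assumes "unit_convergent a"
  shows "unit_convergent (\<lambda>n. of_nat n * a n)"
  unfolding unit_convergent_def
proof (intro allI impI)
  fix z :: real
  assume z: "\<bar>z\<bar> < 1"
  have "summable (\<lambda>n. diffs a n * z ^ n)"
    by (rule termdiff_converges[where K = 1]) (use z assms unit_convergentD in auto)
  from diffs_equiv[OF this] have "summable (\<lambda>n. z * (of_nat n * a n * z ^ (n - Suc 0)))"
    by (intro summable_mult) (auto simp: sums_iff)
  moreover have "z * (of_nat n * a n * z ^ (n - Suc 0)) = of_nat n * a n * z ^ n" for n
    by (cases n) auto
  ultimately show "summable (\<lambda>n. of_nat n * a n * z ^ n)"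
    by simp
qed

lemma unit_convergent_deriv_coeff:
  assumes "unit_convergent a"
  shows "unit_convergent (\<lambda>n. (of_nat n * l) ^ k * a n)"
proof (induction k)
  case (Suc k)
  have "unit_convergent (\<lambda>n. l * (of_nat n * ((of_nat n * l) ^ k * a n)))"
    by (intro unit_convergent_cmult unit_convergent_of_nat_mult Suc)
  then show ?case by (simp add: mult_ac)
qed (use assms in simp)

section \<open>Derivatives and signs of series in \<open>q powr x\<close>\<close>

lemma q_powr_abs_less_one:
  fixes q x :: real
  assumes "0 < q" "q < 1" "0 < x"
  shows "\<bar>q powr x\<bar> < 1"
  using assms powr_less_mono'[of q 0 x] by simp

text \<open>By the chain rule d/dx acts as ln q times z d/dz, and z d/dz multiplies z^n by n. So the
  derivative is again a \<open>q_series\<close>, without index shift.\<close>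

lemma q_series_has_derivative:
  assumes a: "unit_convergent a" and q: "0 < q" "q < 1" and x: "0 < x"
  shows "(q_series q a has_real_derivative q_series q (\<lambda>n. of_nat n * ln q * a n) x) (at x)"
proof -
  define z where "z = q powr x"
  have z: "\<bar>z\<bar> < 1" unfolding z_def using q x by (rule q_powr_abs_less_one)
  have ds: "summable (\<lambda>n. diffs a n * z ^ n)"
    by (rule termdiff_converges[where K = 1]) (use z a unit_convergentD in auto)
  have "((\<lambda>w. \<Sum>n. a n * w ^ n) has_real_derivative (\<Sum>n. diffs a n * z ^ n)) (at z)"
    by (rule termdiffs_strong'[where K = 1]) (use z a unit_convergentD in auto)
  moreover have "((\<lambda>x. q powr x) has_real_derivative z * ln q) (at x)"
    unfolding z_def using q by (auto intro!: derivative_eq_intros)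
  ultimately have D: "(q_series q a has_real_derivative (\<Sum>n. diffs a n * z ^ n) * (z * ln q)) (at x)"
    unfolding q_series_def z_def by (rule DERIV_chain2)
  have "(\<lambda>n. z * ln q * (of_nat n * a n * z ^ (n - Suc 0))) sums (z * ln q * (\<Sum>n. diffs a n * z ^ n))"
    by (intro sums_mult diffs_equiv ds)
  moreover have "z * ln q * (of_nat n * a n * z ^ (n - Suc 0)) = of_nat n * ln q * a n * z ^ n" for n
    by (cases n) auto
  ultimately have "q_series q (\<lambda>n. of_nat n * ln q * a n) x = z * ln q * (\<Sum>n. diffs a n * z ^ n)"
    unfolding q_series_def z_def[symmetric] by (simp add: sums_iff)
  with D show ?thesis by (simp add: mult_ac)
qed

lemma deriv_cong_on_open:
  fixes f g :: "real \<Rightarrow> real"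
  assumes "open S" "x \<in> S" "\<And>y. y \<in> S \<Longrightarrow> f y = g y" "(g has_real_derivative d) (at x)"
  shows "(f has_real_derivative d) (at x)"
  using assms has_field_derivative_transform_within_open[of g d x S f] by auto

lemma q_series_higher_deriv:
  assumes a: "unit_convergent a" and q: "0 < q" "q < 1"
    and F: "\<And>x. 0 < x \<Longrightarrow> F x = q_series q a x" and x: "0 < x"
  shows "(deriv ^^ k) F x = q_series q (\<lambda>n. (of_nat n * ln q) ^ k * a n) x \<and>
    (deriv ^^ k) F field_differentiable at x"
proof -
  define b where "b k n = (of_nat n * ln q) ^ k * a n" for k n
  have bS: "b (Suc k) = (\<lambda>n. of_nat n * ln q * b k n)" for k
    by (auto simp: b_def mult_ac)
  have ub: "unit_convergent (b k)" for k
    unfolding b_def using a by (rule unit_convergent_deriv_coeff)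
  \<comment> \<open>The formula of order k is assumed on the whole half-line, because
    differentiating at x uses it near x. This one fact gives both the induction step and the
    differentiability claim.\<close>
  have D: "((deriv ^^ k) F has_real_derivative q_series q (b (Suc k)) x) (at x)"
    if "0 < x" "\<And>y. 0 < y \<Longrightarrow> (deriv ^^ k) F y = q_series q (b k) y" for k x
  proof (rule deriv_cong_on_open[where S = "{0<..}" and g = "q_series q (b k)"])
    show "(q_series q (b k) has_real_derivative q_series q (b (Suc k)) x) (at x)"
      unfolding bS using ub q that(1) by (rule q_series_has_derivative)
  qed (use that in auto)
  have eq: "(deriv ^^ k) F y = q_series q (b k) y" if "0 < y" for y
    using that
  proof (induction k arbitrary: y)
    case 0
    then show ?case by (simp add: F b_def)
  next
    case (Suc k)
    then show ?case using DERIV_imp_deriv[OF D[of y k]] by simp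
  qed
  show ?thesis
    using eq[OF x] D[OF x eq] unfolding b_def field_differentiable_def by blast
qed

lemma q_series_completely_monotonic:
  assumes a: "unit_convergent a" "\<And>n. 0 \<le> a n" and q: "0 < q" "q < 1"
    and F: "\<And>x. 0 < x \<Longrightarrow> F x = q_series q a x"
  shows "completely_monotonic_on {0<..} F"
  unfolding completely_monotonic_on_def
proof (intro allI ballI conjI)
  fix k :: nat and x :: real
  assume "x \<in> {0<..}"
  then have x: "0 < x" by simp
  note H = q_series_higher_deriv[OF a(1) q F x, of k]
  show "(deriv ^^ k) F field_differentiable at x" using H by blast
  let ?z = "q powr x"
  have z: "\<bar>?z\<bar> < 1" using q x by (rule q_powr_abs_less_one)
  have nonneg: "0 \<le> (-1) ^ k * ((of_nat n * ln q) ^ k * a n * ?z ^ n)" for n :: nat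
  proof -
    have "0 \<le> (of_nat n * - ln q) ^ k * a n * ?z ^ n"
      using q a(2) by (intro mult_nonneg_nonneg zero_le_power) auto
    also have "(of_nat n * - ln q) ^ k = (-1) ^ k * (of_nat n * ln q) ^ k"
      by (metis mult_minus_right mult_minus1 power_mult_distrib)
    finally show ?thesis by (simp add: mult.assoc)
  qed
  have sm: "summable (\<lambda>n. (of_nat n * ln q) ^ k * a n * ?z ^ n)"
    using z by (intro unit_convergentD unit_convergent_deriv_coeff a)
  have "0 \<le> (-1) ^ k * (\<Sum>n. (of_nat n * ln q) ^ k * a n * ?z ^ n)"
    using suminf_nonneg[OF summable_mult[OF sm] nonneg] by (simp only: suminf_mult[OF sm])
  then show "0 \<le> (-1) ^ k * (deriv ^^ k) F x"
    using H by (simp add: q_series_def)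
qed

lemma q_series_nonneg_imp_first_coeff_nonneg:
  assumes a: "unit_convergent a" "a 0 = 0" and q: "0 < q" "q < 1"
    and nonneg: "\<And>x. 0 < x \<Longrightarrow> 0 \<le> q_series q a x"
  shows "0 \<le> a 1"
proof -
  \<comment> \<open>P is the series divided by z, as \<open>a 0 = 0\<close>; its limit at 0 is the
    coefficient of index 1.\<close>
  define P where "P z = (\<Sum>n. a (Suc n) * z ^ n)" for z
  have sm: "summable (\<lambda>n. a (Suc n) * z ^ n)" if "\<bar>z\<bar> < 1" for z
    using unit_convergentD[OF a(1) that] by (simp add: summable_powser_split_head)
  have lim: "(P \<longlongrightarrow> a (Suc 0)) (at 0)"
    by (rule powser_limit_0_strong[where s = 1])
       (use sm in \<open>auto simp: P_def summable_sums\<close>)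
  have P: "0 \<le> P z" if "0 < z" "z < 1" for z
  proof -
    define x where "x = ln z / ln q"
    have x: "0 < x" unfolding x_def using that q by (simp add: divide_neg_neg)
    have "q powr x = z" unfolding x_def powr_def using that q by simp
    then have "q_series q a x = z * P z"
      unfolding q_series_def P_def
      using powser_split_head(1)[OF unit_convergentD[OF a(1)], of z] a(2) that by (simp add: mult.commute)
    then show ?thesis using nonneg[OF x] that by (simp add: zero_le_mult_iff)
  qed
  have "0 \<le> a (Suc 0)"
  proof (rule tendsto_lowerbound)
    show "(P \<longlongrightarrow> a (Suc 0)) (at_right 0)"
      using lim filterlim_at_split by blast
    show "\<forall>\<^sub>F z in at_right 0. 0 \<le> P z"
      unfolding eventually_at_right_field using P by (intro exI[of _ 1]) auto
  qed simp
  then show ?thesis by simp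
qed

section \<open>Series for the logarithm of the q-gamma function and for its derivative\<close>

text \<open>At \<open>n = 0\<close> both coefficients below are \<open>0\<close>, because \<open>1 / 0 = 0\<close>.\<close>

definition psi_coeff :: "real \<Rightarrow> nat \<Rightarrow> real" where
  "psi_coeff q n = 1 / (1 - q ^ n)"

definition lnGamma_coeff :: "real \<Rightarrow> nat \<Rightarrow> real" where
  "lnGamma_coeff q n = psi_coeff q n / of_nat n"

lemma psi_coeff_nonneg: "0 < q \<Longrightarrow> q < 1 \<Longrightarrow> 0 \<le> psi_coeff q n"
  by (simp add: psi_coeff_def power_le_one)

lemma psi_coeff_le:
  assumes "0 < q" "q < 1"
  shows "psi_coeff q n \<le> 1 / (1 - q)"
proof (cases n)
  case (Suc m)
  have "q ^ n \<le> q" using assms power_decreasing[of 1 n q] Suc by simp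
  then show ?thesis unfolding psi_coeff_def using assms by (intro divide_left_mono) (auto intro!: mult_pos_pos)
qed (use assms in \<open>simp add: psi_coeff_def\<close>)

lemma unit_convergent_psi_coeff:
  assumes "0 < q" "q < 1"
  shows "unit_convergent (psi_coeff q)"
  by (rule unit_convergent_bounded[where B = "1 / (1 - q)"])
     (use psi_coeff_nonneg[OF assms] psi_coeff_le[OF assms] in simp)

lemma unit_convergent_lnGamma_coeff:
  assumes "0 < q" "q < 1"
  shows "unit_convergent (lnGamma_coeff q)"
proof (rule unit_convergent_bounded[where B = "1 / (1 - q)"])
  fix n
  have "psi_coeff q n / of_nat n \<le> psi_coeff q n"
    using psi_coeff_nonneg[OF assms, of n] by (cases n) (auto simp: field_simps)
  then show "\<bar>lnGamma_coeff q n\<bar> \<le> 1 / (1 - q)"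
    using psi_coeff_le[OF assms, of n] psi_coeff_nonneg[OF assms, of n]
    by (simp add: lnGamma_coeff_def)
qed

text \<open>Up to the factor ln q, this turns the differentiated series of ln Gamma_q into that of
  psi_q.\<close>

lemma of_nat_mult_lnGamma_coeff: "of_nat n * lnGamma_coeff q n = psi_coeff q n"
  by (cases "n = 0") (auto simp: lnGamma_coeff_def psi_coeff_def)

text \<open>Mercator's series; its term at n = 0 is 0 by the convention for division by 0.\<close>

lemma neg_ln_one_minus_sums:
  fixes z :: real
  assumes "\<bar>z\<bar> < 1"
  shows "(\<lambda>n. z ^ n / of_nat n) sums (- ln (1 - z))"
proof -
  have "(\<lambda>n. - (- (z ^ n) / of_nat n)) sums (- ln (1 - z))"
    using sums_minus[OF ln_series'[of "- z"]] assms by simp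
  then show ?thesis by simp
qed

text \<open>The functional equation E(qw) = E(w) + ln(1 - w) telescopes the partial products, so no
  double series has to be rearranged.\<close>

lemma qpochhammer_inf_eq_exp:
  assumes q: "0 < q" "q < 1" and z: "0 < z" "z < 1"
  shows "qpochhammer_inf z q = exp (- (\<Sum>n. lnGamma_coeff q n * z ^ n))"
proof -
  define E where "E w = (\<Sum>n. lnGamma_coeff q n * w ^ n)" for w
  have sm: "(\<lambda>n. lnGamma_coeff q n * w ^ n) sums E w" if "\<bar>w\<bar> < 1" for w
    unfolding E_def using unit_convergentD[OF unit_convergent_lnGamma_coeff[OF q] that]
    by (rule summable_sums)
  \<comment> \<open>Passing from w to qw brings in the factor 1 - q^n, which cancels the denominator
    and leaves Mercator's series.\<close>
  have step: "E (q * w) = E w + ln (1 - w)" if "0 < w" "w < 1" for w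
  proof -
    have qw: "\<bar>q * w\<bar> < 1"
      using q that mult_strict_mono[of q 1 w 1] by (simp add: abs_mult)
    have "(\<lambda>n. lnGamma_coeff q n * w ^ n - lnGamma_coeff q n * (q * w) ^ n) sums (E w - E (q * w))"
      using that qw by (intro sums_diff sm) auto
    moreover have "lnGamma_coeff q n * w ^ n - lnGamma_coeff q n * (q * w) ^ n = w ^ n / of_nat n" for n
    proof (cases "n = 0")
      case False
      then have "1 - q ^ n \<noteq> 0" using q power_strict_mono[of q 1 n] by simp
      then have "psi_coeff q n * (1 - q ^ n) = 1" by (simp add: psi_coeff_def)
      moreover have "lnGamma_coeff q n * w ^ n - lnGamma_coeff q n * (q * w) ^ n
          = psi_coeff q n * (1 - q ^ n) * (w ^ n / of_nat n)"
        by (simp add: lnGamma_coeff_def power_mult_distrib algebra_simps)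
      ultimately show ?thesis by simp
    qed (simp add: lnGamma_coeff_def)
    ultimately have "(\<lambda>n. w ^ n / of_nat n) sums (E w - E (q * w))" by simp
    then have "E w - E (q * w) = - ln (1 - w)"
      using neg_ln_one_minus_sums[of w] that sums_unique2 by fastforce
    then show ?thesis by simp
  qed
  have zq: "0 < z * q ^ N \<and> z * q ^ N < 1" for N
    using q z mult_less_le_imp_less[of z 1 "q ^ N" 1] by (simp add: power_le_one)
  have part: "(\<Prod>n<N. 1 - z * q ^ n) = exp (E (z * q ^ N) - E z)" for N
  proof (induction N)
    case (Suc N)
    have "E (z * q ^ Suc N) = E (z * q ^ N) + ln (1 - z * q ^ N)"
      using step[of "z * q ^ N"] zq[of N] by (simp add: mult_ac)
    moreover have "exp (ln (1 - z * q ^ N)) = 1 - z * q ^ N"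
      using zq[of N] by simp
    ultimately show ?case using Suc by (simp add: exp_add exp_diff)
  qed simp
  \<comment> \<open>E tends to its constant coefficient, which is 0, along the nonzero arguments z
    q^N.\<close>
  have "(E \<longlongrightarrow> lnGamma_coeff q 0) (at 0)"
    by (rule powser_limit_0_strong[where s = 1]) (use sm in auto)
  moreover have "filterlim (\<lambda>N. z * q ^ N) (at 0) sequentially"
    unfolding filterlim_at
    using q z tendsto_mult_right_zero[OF LIMSEQ_realpow_zero[of q], of z] by auto
  ultimately have "(\<lambda>N. E (z * q ^ N)) \<longlonglongrightarrow> 0"
    by (auto dest: filterlim_compose simp: lnGamma_coeff_def)
  then have "(\<lambda>N. exp (E (z * q ^ N) - E z)) \<longlonglongrightarrow> exp (0 - E z)"
    by (intro tendsto_intros)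
  then have "(\<lambda>N. \<Prod>n<N. 1 - z * q ^ n) \<longlonglongrightarrow> exp (- E z)"
    by (simp add: part)
  \<comment> \<open>\<open>has_prod\<close> takes products over n \<le> N and a nonzero limit; the
    exponential is nonzero.\<close>
  then have "(\<lambda>N. \<Prod>n\<le>N. 1 - z * q ^ n) \<longlonglongrightarrow> exp (- E z)"
    by (subst (asm) filterlim_sequentially_Suc[symmetric]) (simp add: lessThan_Suc_atMost)
  then have "(\<lambda>n. 1 - z * q ^ n) has_prod exp (- E z)"
    by (auto simp: has_prod_def raw_has_prod_def)
  then show ?thesis
    unfolding qpochhammer_inf_def E_def by (rule has_prod_unique[symmetric])
qed

text \<open>The subtracted value at 1 is the contribution of the numerator (q;q)_inf, since q^1 =
  q.\<close>

definition ln_q_Gamma :: "real \<Rightarrow> real \<Rightarrow> real" where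
  "ln_q_Gamma q x =
     q_series q (lnGamma_coeff q) x - q_series q (lnGamma_coeff q) 1 + (1 - x) * ln (1 - q)"

lemma q_Gamma_eq_exp:
  assumes q: "0 < q" "q < 1" and x: "0 < x"
  shows "q_Gamma q x = exp (ln_q_Gamma q x)"
proof -
  have z: "0 < q powr x" "q powr x < 1"
    using q q_powr_abs_less_one[OF q x] by auto
  show ?thesis
    unfolding q_Gamma_def ln_q_Gamma_def q_series_def
      qpochhammer_inf_eq_exp[OF q z] qpochhammer_inf_eq_exp[OF q q]
    using q by (simp add: powr_def exp_add exp_diff exp_minus field_simps)
qed

lemma q_psi_eq_q_series:
  assumes q: "0 < q" "q < 1" and x: "0 < x"
  shows "q_psi q x = ln q * q_series q (psi_coeff q) x - ln (1 - q)"
proof -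
  let ?d = "q_series q (\<lambda>n. of_nat n * ln q * lnGamma_coeff q n) x - ln (1 - q)"
  have "((\<lambda>x. exp (ln_q_Gamma q x)) has_real_derivative exp (ln_q_Gamma q x) * ?d) (at x)"
    unfolding ln_q_Gamma_def
    by (rule derivative_eq_intros refl
          q_series_has_derivative[OF unit_convergent_lnGamma_coeff[OF q] q x])+ simp
  then have "(q_Gamma q has_real_derivative exp (ln_q_Gamma q x) * ?d) (at x)"
    by (rule deriv_cong_on_open[where S = "{0<..}", rotated 3]) (simp_all add: q x q_Gamma_eq_exp)
  then have "q_psi q x = ?d"
    unfolding q_psi_def q_Gamma_eq_exp[OF q x] by (simp only: DERIV_imp_deriv) simp
  moreover have "(\<lambda>n. of_nat n * ln q * lnGamma_coeff q n) = (\<lambda>n. ln q * psi_coeff q n)"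
    by (simp add: mult.left_commute mult.commute flip: of_nat_mult_lnGamma_coeff)
  moreover have "q_series q (\<lambda>n. ln q * psi_coeff q n) x = ln q * q_series q (psi_coeff q) x"
    unfolding q_series_def
    using suminf_mult[OF unit_convergentD[OF unit_convergent_psi_coeff[OF q] q_powr_abs_less_one[OF q x]], of "ln q"]
    by (simp add: mult.assoc)
  ultimately show ?thesis by simp
qed

section \<open>The series of \<open>- f_qsc q s c x\<close>\<close>

definition f_coeff :: "real \<Rightarrow> real \<Rightarrow> real \<Rightarrow> nat \<Rightarrow> real" where
  "f_coeff q s c n = psi_coeff q n *
     ((q powr s) ^ n / of_nat n - q ^ n / of_nat n + (1 - s) * ln q * (q powr c) ^ n)"

text \<open>Splits the coefficient into scaled multiples of the two basic sequences, the shape to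
  which the closure rules for \<open>unit_convergent\<close> apply.\<close>

lemma f_coeff_eq:
  "f_coeff q s c n = lnGamma_coeff q n * (q powr s) ^ n + (-1) * (lnGamma_coeff q n * q ^ n)
     + (1 - s) * ln q * (psi_coeff q n * (q powr c) ^ n)"
  by (simp add: f_coeff_def lnGamma_coeff_def algebra_simps)

lemma unit_convergent_f_coeff:
  assumes q: "0 < q" "q < 1" and "0 < s" "0 < c"
  shows "unit_convergent (f_coeff q s c)"
  unfolding f_coeff_eq[abs_def]
proof (intro unit_convergent_add unit_convergent_cmult unit_convergent_mult_power
    unit_convergent_lnGamma_coeff unit_convergent_psi_coeff)
  show "q powr s \<le> 1" "q powr c \<le> 1"
    using q_powr_abs_less_one[OF q, of s] q_powr_abs_less_one[OF q, of c] assms by auto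
qed (use q in auto)

lemma neg_f_qsc_eq_q_series:
  assumes q: "0 < q" "q < 1" and s: "0 < s" and c: "0 < c" and x: "0 < x"
  shows "- f_qsc q s c x = q_series q (f_coeff q s c) x"
proof -
  \<comment> \<open>Replacing x by x + t multiplies the n-th coefficient by (q^t)^n.\<close>
  have shift: "(\<lambda>n. a n * (q powr t) ^ n * (q powr x) ^ n) sums q_series q a (x + t)"
    if "unit_convergent a" "0 < t" for a t
  proof -
    have "(\<lambda>n. a n * (q powr (x + t)) ^ n) sums q_series q a (x + t)"
      unfolding q_series_def
      using that x by (intro summable_sums unit_convergentD q_powr_abs_less_one q) auto
    then show ?thesis by (simp add: powr_add power_mult_distrib mult_ac)
  qed
  note G = shift[OF unit_convergent_lnGamma_coeff[OF q]]
  \<comment> \<open>Writing \<open>q powr 1\<close> for q makes the middle term an instance of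
    \<open>shift\<close> with t = 1.\<close>
  have "(\<lambda>n. lnGamma_coeff q n * (q powr s) ^ n * (q powr x) ^ n
        - lnGamma_coeff q n * (q powr 1) ^ n * (q powr x) ^ n
        + (1 - s) * ln q * (psi_coeff q n * (q powr c) ^ n * (q powr x) ^ n))
      sums (q_series q (lnGamma_coeff q) (x + s) - q_series q (lnGamma_coeff q) (x + 1)
        + (1 - s) * ln q * q_series q (psi_coeff q) (x + c))"
    by (intro sums_add sums_diff sums_mult G shift unit_convergent_psi_coeff q s c) simp
  \<comment> \<open>The gamma terms contribute (s - 1) ln(1 - q) and the psi term (1 - s) ln(1 - q),
    so these cancel.\<close>
  moreover have "q_series q (lnGamma_coeff q) (x + s) - q_series q (lnGamma_coeff q) (x + 1)
        + (1 - s) * ln q * q_series q (psi_coeff q) (x + c) = - f_qsc q s c x"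
    using q s c x by (simp add: f_qsc_def q_Gamma_eq_exp q_psi_eq_q_series ln_q_Gamma_def algebra_simps)
  moreover have "lnGamma_coeff q n * (q powr s) ^ n * (q powr x) ^ n
        - lnGamma_coeff q n * (q powr 1) ^ n * (q powr x) ^ n
        + (1 - s) * ln q * (psi_coeff q n * (q powr c) ^ n * (q powr x) ^ n)
      = f_coeff q s c n * (q powr x) ^ n" for n
    using q by (simp add: f_coeff_eq algebra_simps)
  ultimately have "(\<lambda>n. f_coeff q s c n * (q powr x) ^ n) sums (- f_qsc q s c x)"
    by simp
  then show ?thesis by (simp add: q_series_def sums_iff)
qed

section \<open>Jensen's inequality for powers of \<open>q powr u\<close>\<close>

text \<open>Bernoulli's inequality for y/m - 1 \<ge> -1, scaled by m^n.\<close>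

lemma power_ge_tangent:
  fixes y m :: real
  assumes "0 \<le> y" "0 < m"
  shows "m ^ n + of_nat n * m ^ (n - 1) * (y - m) \<le> y ^ n"
proof (cases n)
  case (Suc k)
  have "1 + of_nat n * (y / m - 1) \<le> (1 + (y / m - 1)) ^ n"
    using assms by (intro Bernoulli_inequality) simp
  then have "m ^ n * (1 + of_nat n * (y / m - 1)) \<le> m ^ n * (y / m) ^ n"
    using assms by (intro mult_left_mono) auto
  also have "m ^ n * (y / m) ^ n = y ^ n"
    using assms by (simp add: power_divide)
  also have "m ^ n * (1 + of_nat n * (y / m - 1)) = m ^ n + of_nat n * m ^ (n - 1) * (y - m)"
    using assms Suc by (simp add: field_simps)
  finally show ?thesis .
qed simp

text \<open>Jensen's inequality for \<open>y \<mapsto> y\<^sup>n\<close> and the mean \<open>m\<close> of \<open>q\<^sup>u\<close> over \<open>[s, 1]\<close>: the tangent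
  inequality at \<open>m\<close> is integrated over \<open>u\<close> by means of the explicit antiderivative \<open>H\<close>.\<close>

lemma mean_q_powr_power_le:
  fixes q s :: real
  assumes q: "0 < q" "q < 1" and s: "s < 1" and n: "0 < n"
    and m: "m = (q powr s - q) / ((s - 1) * ln q)"
  shows "(1 - s) * - ln q * m ^ n \<le> (q powr s) ^ n / of_nat n - q ^ n / of_nat n"
proof -
  have lq: "ln q < 0" using q by simp
  have "q powr 1 < q powr s" using q s by (intro powr_less_mono') auto
  then have m0: "0 < m"
    unfolding m using q s lq by (intro divide_pos_pos mult_neg_neg) auto
  \<comment> \<open>Equivalently, the integral of q^u over [s, 1], which is (q - q^s) / ln q, equals
    m (1 - s).\<close>
  have mean: "q powr s - q = m * ((s - 1) * ln q)"
    unfolding m using s lq by simp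
  define H where "H u = (q powr u) ^ n / (of_nat n * ln q) - m ^ n * u
      - of_nat n * m ^ (n - 1) * (q powr u / ln q - m * u)" for u
  have "\<exists>y. (H has_real_derivative y) (at u) \<and> 0 \<le> y" for u
  proof -
    have "(H has_real_derivative
        (q powr u) ^ n - m ^ n - of_nat n * m ^ (n - 1) * (q powr u - m)) (at u)"
    proof -
      \<comment> \<open>Splitting off one factor matches the exponent n - 1 produced by
        differentiating the power.\<close>
      have e: "(q powr u) ^ n = q powr u * (q powr u) ^ (n - 1)"
        using n by (simp add: power_eq_if)
      show ?thesis unfolding H_def e
        by (rule derivative_eq_intros refl | use q lq n in \<open>simp add: field_simps\<close>)+
    qed
    moreover have "0 \<le> (q powr u) ^ n - m ^ n - of_nat n * m ^ (n - 1) * (q powr u - m)"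
      using power_ge_tangent[of "q powr u" m n] m0 by simp
    ultimately show ?thesis by blast
  qed
  then have "H s \<le> H 1"
    by (rule DERIV_nonneg_imp_nondecreasing[OF less_imp_le[OF s]])
  moreover have "H 1 - H s = (q ^ n - (q powr s) ^ n) / (of_nat n * ln q) - m ^ n * (1 - s)
      + of_nat n * m ^ (n - 1) * ((q powr s - q) / ln q + m * (1 - s))"
    unfolding H_def using q by (simp add: diff_divide_distrib algebra_simps)
  \<comment> \<open>The linear part of the tangent integrates to 0 because m is the mean.\<close>
  moreover have "(q powr s - q) / ln q + m * (1 - s) = 0"
    unfolding mean using lq by (simp add: field_simps)
  ultimately have "m ^ n * (1 - s) \<le> (q ^ n - (q powr s) ^ n) / (of_nat n * ln q)"
    by simp
  then have "- ln q * (m ^ n * (1 - s)) \<le> - ln q * ((q ^ n - (q powr s) ^ n) / (of_nat n * ln q))"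
    using lq by (intro mult_left_mono) auto
  also have "\<dots> = (q powr s) ^ n / of_nat n - q ^ n / of_nat n"
    using lq n by (simp add: field_simps)
  finally show ?thesis by (simp add: mult_ac)
qed

section \<open>The threshold for c and the equivalence\<close>

text \<open>\<open>b_bound q s\<close> is the exponent b for which q^b equals the mean; since ln q <
  0, passing to powers of q reverses the order.\<close>

lemma b_bound_le_iff:
  fixes q s c :: real
  assumes q: "0 < q" "q < 1" and s: "s < 1"
  shows "b_bound q s \<le> c \<longleftrightarrow> q powr c \<le> (q powr s - q) / ((s - 1) * ln q)"
proof -
  have lq: "ln q < 0" using q by simp
  let ?m = "(q powr s - q) / ((s - 1) * ln q)"
  have "q powr 1 < q powr s" using q s by (intro powr_less_mono') auto
  then have m0: "0 < ?m"
    using q s lq by (intro divide_pos_pos mult_neg_neg) auto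
  have "b_bound q s \<le> c \<longleftrightarrow> c * ln q \<le> ln ?m"
    unfolding b_bound_def using lq by (simp add: neg_divide_le_eq)
  also have "\<dots> \<longleftrightarrow> q powr c \<le> ?m"
    using m0 q by (simp add: ln_ge_iff powr_def)
  finally show ?thesis .
qed

theorem theorem3p2:
  fixes q s c :: real
  assumes "0 < q" and "q < 1" and "0 < s" and "s < 1" and "c > 0"
  shows "completely_monotonic_on {0<..} (\<lambda>x. - f_qsc q s c x) \<longleftrightarrow> c \<ge> b_bound q s"
proof
  note q = assms(1,2)
  note eq = neg_f_qsc_eq_q_series[OF q assms(3,5)]
  note conv = unit_convergent_f_coeff[OF q assms(3,5)]
  {
    assume "completely_monotonic_on {0<..} (\<lambda>x. - f_qsc q s c x)"
    \<comment> \<open>Necessity uses order 0 only, the nonnegativity of the function itself.\<close>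
    then have "0 \<le> (-1) ^ 0 * (deriv ^^ 0) (\<lambda>x. - f_qsc q s c x) x" if "0 < x" for x
      using that unfolding completely_monotonic_on_def by blast
    then have "0 \<le> q_series q (f_coeff q s c) x" if "0 < x" for x
      unfolding eq[OF that, symmetric] using that by simp
    then have "0 \<le> f_coeff q s c 1"
      by (intro q_series_nonneg_imp_first_coeff_nonneg[OF conv _ q])
         (auto simp: f_coeff_def psi_coeff_def)
    \<comment> \<open>The factor \<open>psi_coeff q 1\<close> = 1 / (1 - q) is positive, so the sign
      is that of the bracket.\<close>
    then have "0 \<le> q powr s - q + (1 - s) * ln q * q powr c"
      using q by (simp add: f_coeff_def psi_coeff_def zero_le_divide_iff)
    then have "q powr c * ((s - 1) * ln q) \<le> q powr s - q"
      by (simp add: algebra_simps)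
    moreover have "0 < (s - 1) * ln q" using assms by (intro mult_neg_neg) auto
    ultimately have "q powr c \<le> (q powr s - q) / ((s - 1) * ln q)"
      by (simp only: pos_le_divide_eq)
    then show "b_bound q s \<le> c" using b_bound_le_iff[OF q assms(4)] by simp
  }
  assume "b_bound q s \<le> c"
  then have le: "q powr c \<le> (q powr s - q) / ((s - 1) * ln q)" (is "_ \<le> ?m")
    using b_bound_le_iff[OF q assms(4)] by simp
  have "0 \<le> f_coeff q s c n" for n
  proof (cases "n = 0")
    case False
    \<comment> \<open>The subtracted term grows when q^c is replaced by the mean, where Jensen's
      inequality bounds it.\<close>
    have "(1 - s) * - ln q * (q powr c) ^ n \<le> (1 - s) * - ln q * ?m ^ n"
      using le assms by (intro mult_left_mono power_mono mult_nonneg_nonneg) auto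
    also have "\<dots> \<le> (q powr s) ^ n / of_nat n - q ^ n / of_nat n"
      using mean_q_powr_power_le[OF q assms(4) _ refl] False by simp
    finally show ?thesis
      unfolding f_coeff_def using psi_coeff_nonneg[OF q] by (intro mult_nonneg_nonneg) auto
  qed (simp add: f_coeff_def psi_coeff_def)
  then show "completely_monotonic_on {0<..} (\<lambda>x. - f_qsc q s c x)"
    by (rule q_series_completely_monotonic[OF conv _ q eq])
qed

end
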